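(* Let $h\ge 2$ be an integer and let $q$ be a prime power. (1) Let $\theta$ be the fixed generator of $\mathbb{F}_{q^h}^\times$ and let $b\in\mathbb{Z}/(q^h-1)\mathbb{Z}$ be such that $\theta^b$ has algebraic degree $h$ over $\mathbb{F}_q$. Then $\mathrm{BoseCh}_h(q,b)$ is a $B_h$-set in $\mathbb{Z}/(q^h-1)\mathbb{Z}$ with $q$ distinct elements. (2) Let $\theta$ be the fixed generator of $\mathbb{F}_{q^{h+1}}^\times$ and let $b\in\mathbb{Z}/M\mathbb{Z}$, where $M=\frac{q^{h+1}-1}{q-1}$, be such that $\theta^b$ has algebraic degree $h+1$ over $\mathbb{F}_q$. Then $\mathrm{Singer}_h(q,b)$ is a $B_h$-set in $\mathbb{Z}/M\mathbb{Z}$ with $q+1$ distinct elements.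
   Context: A subset $\mathcal{A}$ of a commutative semigroup $X$ (written additively) is a $B_h$-set in $X$ if the only solutions to $a_1+\dots+a_h=b_1+\dots+b_h$ with all $a_i,b_i\in\mathcal{A}$ are the trivial ones, i.e. those with $\{a_1,\dots,a_h\}=\{b_1,\dots,b_h\}$ as multisets. Choice of generator: for each finite field $\mathbb{F}_{p^n}$ ($p$ prime) a generator $\theta$ of the cyclic group $\mathbb{F}_{p^n}^\times$ is fixed once and for all, namely a root of the Conway polynomial $C_{p,n}\in\mathbb{F}_p[x]$. The only properties of Conway polynomials that are used are that $C_{p,n}$ is uniquely determined by $p,n$, is irreducible over $\mathbb{F}_p$ with $\mathbb{F}_p[x]/(C_{p,n})\cong\mathbb{F}_{p^n}$, and that its root $\theta$ generates $\mathbb{F}_{p^n}^\times$. $\mathrm{BoseCh}_h(q,b)$: set $M=q^h-1$, let $\theta$ be the fixed generator of $\mathbb{F}_{q^h}^\times$, and let $b\in\mathbb{Z}/M\mathbb{Z}$ be such that $\theta^b$ has algebraic degree $h$ over $\mathbb{F}_q$. Then $$\mathrm{BoseCh}_h(q,b):=\{a\in\mathbb{Z}/M\mathbb{Z} : \theta^a=\theta^b+v \text{ for some } v\in\mathbb{F}_q\}.$$ $\mathrm{Singer}_h(q,b)$: set $M=\frac{q^{h+1}-1}{q-1}$, let $\theta$ be the fixed generator of $\mathbb{F}_{q^{h+1}}^\times$, and let $b\in\mathbb{Z}/M\mathbb{Z}$ be such that $\theta^b$ has algebraic degree $h+1$ over $\mathbb{F}_q$. Then $$\mathrm{Singer}_h(q,b):=\{a\in\mathbb{Z}/M\mathbb{Z}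 : \theta^a=u\theta^b+v \text{ for some } u,v\in\mathbb{F}_q\}.$$ Since $\theta^{M}\in\mathbb{F}_q^\times$, the condition does not depend on the integer representatives chosen for the classes $a,b$ modulo $M$. *)

theory Defs
  imports
    "HOL-Algebra.Elementary_Groups"
    "HOL-Algebra.Finite_Extensions"
    "HOL-Algebra.Multiplicative_Group"
    "HOL-Number_Theory.Prime_Powers"
begin

(* The sum a_1 + ... + a_n of a nonempty list in a commutative semigroup.  The semigroup is given
   by the carrier and the binary operation of a monoid record; the unit of the record is not used. *)
definition semigroup_sum :: "('a, 'm) monoid_scheme \<Rightarrow> 'a list \<Rightarrow> 'a" where
  "semigroup_sum S xs = foldl (\<lambda>x y. x \<otimes>\<^bsub>S\<^esub> y) (hd xs) (tl xs)"

definition Bh_set :: "nat \<Rightarrow> ('a, 'm) monoid_scheme \<Rightarrow> 'a set \<Rightarrow> bool" where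
  "Bh_set h S A \<longleftrightarrow>
     A \<subseteq> carrier S \<and>
     (\<forall>as bs. length as = h \<and> length bs = h \<and> set as \<subseteq> A \<and> set bs \<subseteq> A \<and>
        semigroup_sum S as = semigroup_sum S bs \<longrightarrow> mset as = mset bs)"

definition finite_field_setup ::
    "('a, 'm) ring_scheme \<Rightarrow> 'a set \<Rightarrow> nat \<Rightarrow> nat \<Rightarrow> 'a \<Rightarrow> bool" where
  "finite_field_setup F K q n \<theta> \<longleftrightarrow>
     field F \<and> order F = q ^ n \<and> subfield K F \<and> card K = q \<and>
     \<theta> \<in> carrier (mult_of F) \<and> generate (mult_of F) {\<theta>} = carrier (mult_of F)"

(* The description in ring.Irr of the minimal polynomial is meaningful only for algebraic x. *)
definition has_algebraic_degree ::
    "('a, 'm) ring_scheme \<Rightarrow> 'a set \<Rightarrow> 'a \<Rightarrow> nat \<Rightarrow> bool" where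
  "has_algebraic_degree F K x n \<longleftrightarrow>
     x \<in> carrier F \<and> \<not> ring.transcendental F K x \<and> Polynomials.degree (ring.Irr F K x) = n"

(* Elements of Z/MZ are the representatives in {0..<M}, as in integer_mod_group M. *)
definition BoseCh ::
    "('a, 'm) ring_scheme \<Rightarrow> 'a set \<Rightarrow> 'a \<Rightarrow> nat \<Rightarrow> nat \<Rightarrow> int \<Rightarrow> int set" where
  "BoseCh F K \<theta> h q b =
     {a \<in> carrier (integer_mod_group (q ^ h - 1)).
        \<exists>v\<in>K. \<theta> [^]\<^bsub>F\<^esub> a = \<theta> [^]\<^bsub>F\<^esub> b \<oplus>\<^bsub>F\<^esub> v}"

(* The division by q - 1 is exact. *)
definition Singer_modulus :: "nat \<Rightarrow> nat \<Rightarrow> nat" where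
  "Singer_modulus h q = (q ^ (h + 1) - 1) div (q - 1)"

definition Singer ::
    "('a, 'm) ring_scheme \<Rightarrow> 'a set \<Rightarrow> 'a \<Rightarrow> nat \<Rightarrow> nat \<Rightarrow> int \<Rightarrow> int set" where
  "Singer F K \<theta> h q b =
     {a \<in> carrier (integer_mod_group (Singer_modulus h q)).
        \<exists>u\<in>K. \<exists>v\<in>K. \<theta> [^]\<^bsub>F\<^esub> a = (u \<otimes>\<^bsub>F\<^esub> \<theta> [^]\<^bsub>F\<^esub> b) \<oplus>\<^bsub>F\<^esub> v}"

end

theory Submission
  imports Defs
begin

text \<open>
  Put \<open>x = \<theta>\<^sup>b\<close>. The elements of both sets are discrete logarithms of values \<open>u x + v\<close> of linear
  forms with coefficients in \<open>K\<close>. A coincidence of two sums of \<open>h\<close> elements says, after raising \<open>\<theta>\<close>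
  to these exponents, that two products of \<open>h\<close> linear forms take the same value at \<open>x\<close>: exactly in
  the Bose--Chowla case, where exponents are taken modulo the order of \<open>\<theta>\<close>, and up to a scalar
  in \<open>K\<^sup>\<times>\<close> in the Singer case, where they are taken modulo the index of \<open>K\<^sup>\<times>\<close>.

  The difference of the two products is a polynomial over \<open>K\<close> which vanishes at \<open>x\<close> and has degree
  less than that of \<open>x\<close>: in the Singer case because \<open>h < h + 1\<close>, in the Bose--Chowla case because both
  products are monic of degree \<open>h\<close>. So the products agree as polynomials
  (\<open>form_products_agree\<close>), and their linear factors agree up to order and scalars
  (\<open>linear_forms_unique\<close>).

  An exponent is determined by its form up to a scalar, since the powers of \<open>\<theta>\<close> lying in a subgroup
  of index \<open>M\<close> are those with exponent divisible by \<open>M\<close> (\<open>int_pow_mem_subgroup_iff\<close>). This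
  transports uniqueness back to the exponents and also yields the cardinalities: there is one
  exponent for each of the \<open>q\<close> affine points, respectively for each of the \<open>q + 1\<close> points of the
  projective line over \<open>K\<close>. \<open>Bh_set_linear_form_exponents\<close> treats both cases at once.
\<close>

section \<open>Products over lists\<close>

definition list_prod :: "('a, 'm) monoid_scheme \<Rightarrow> ('c \<Rightarrow> 'a) \<Rightarrow> 'c list \<Rightarrow> 'a" where
  "list_prod G f as = foldr (\<lambda>a z. f a \<otimes>\<^bsub>G\<^esub> z) as \<one>\<^bsub>G\<^esub>"

lemma list_prod_Nil [simp]: "list_prod G f [] = \<one>\<^bsub>G\<^esub>"
  and list_prod_Cons [simp]: "list_prod G f (a # as) = f a \<otimes>\<^bsub>G\<^esub> list_prod G f as"
  by (simp_all add: list_prod_def)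

lemma list_prod_cong:
  "(\<And>a. a \<in> set as \<Longrightarrow> f a = g a) \<Longrightarrow> list_prod G f as = list_prod G g as"
  by (induction as) auto

lemma (in monoid) list_prod_closed:
  "f ` set as \<subseteq> carrier G \<Longrightarrow> list_prod G f as \<in> carrier G"
  by (induction as) auto

lemma (in comm_monoid) list_prod_remove1:
  assumes "f ` set as \<subseteq> carrier G" "a \<in> set as"
  shows "list_prod G f as = f a \<otimes> list_prod G f (remove1 a as)"
  using assms
proof (induction as)
  case (Cons b as)
  have "list_prod G f (remove1 a as) \<in> carrier G"
    using Cons.prems(1) set_remove1_subset[of a as] by (intro list_prod_closed) auto
  with Cons show ?case by (auto simp: m_lcomm)
qed simp

lemma (in domain) list_prod_eq_zero_iff:
  assumes "f ` set as \<subseteq> carrier R"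
  shows "list_prod R f as = \<zero> \<longleftrightarrow> (\<exists>a\<in>set as. f a = \<zero>)"
  using assms by (induction as) (auto simp: integral_iff list_prod_closed)

lemma (in group) list_prod_int_pow:
  assumes "t \<in> carrier G"
  shows "list_prod G (\<lambda>a. t [^] (a :: int)) as = t [^] sum_list as"
  using assms by (induction as) (simp_all add: int_pow_mult)

section \<open>Coefficients of a product of linear forms\<close>

text \<open>
  Polynomials are kept as coefficient lists, highest coefficient first, in the convention of
  \<^term>\<open>ring.eval\<close>, but without normalisation: a product of \<open>k\<close> linear forms always has length
  \<open>k + 1\<close>, and its head is the coefficient of \<open>X\<^sup>k\<close> even if that is zero. So the head can
  be read as the value of the product at infinity, next to its values at the affine points.
\<close>

definition (in ring) list_comb :: "'a \<Rightarrow> 'a list \<Rightarrow> 'a \<Rightarrow> 'a list \<Rightarrow> 'a list" where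
  "list_comb \<alpha> p \<beta> q = map2 (\<lambda>s t. \<alpha> \<otimes> s \<oplus> \<beta> \<otimes> t) p q"

lemma (in ring) length_list_comb [simp]:
  "length p = length q \<Longrightarrow> length (list_comb \<alpha> p \<beta> q) = length p"
  by (simp add: list_comb_def)

lemma (in ring) hd_list_comb:
  "p \<noteq> [] \<Longrightarrow> q \<noteq> [] \<Longrightarrow> hd (list_comb \<alpha> p \<beta> q) = \<alpha> \<otimes> hd p \<oplus> \<beta> \<otimes> hd q"
  by (cases p; cases q) (simp_all add: list_comb_def)

lemma (in ring) set_list_comb:
  assumes "subring K R" "set p \<subseteq> K" "set q \<subseteq> K" "\<alpha> \<in> K" "\<beta> \<in> K"
  shows "set (list_comb \<alpha> p \<beta> q) \<subseteq> K"
proof -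
  have "\<alpha> \<otimes> s \<oplus> \<beta> \<otimes> t \<in> K" if "(s, t) \<in> set (zip p q)" for s t
    using that assms set_zip_leftD[OF that] set_zip_rightD[OF that]
    by (auto intro!: subringE(6,7)[OF assms(1)])
  then show ?thesis by (auto simp: list_comb_def)
qed

lemma (in cring) eval_list_comb:
  assumes "length p = length q" "set p \<subseteq> carrier R" "set q \<subseteq> carrier R"
    and "\<alpha> \<in> carrier R" "\<beta> \<in> carrier R" "r \<in> carrier R"
  shows "eval (list_comb \<alpha> p \<beta> q) r = \<alpha> \<otimes> eval p r \<oplus> \<beta> \<otimes> eval q r"
  using assms(1-3)
proof (induction p q rule: list_induct2)
  case Nil
  then show ?case using assms by (simp add: list_comb_def)
next
  case (Cons s p t q)
  have *: "s \<in> carrier R" "t \<in> carrier R" "eval p r \<in> carrier R" "eval q r \<in> carrier R"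
      "r [^] length q \<in> carrier R"
    using Cons.prems assms(6) by (auto intro: eval_in_carrier)
  have "list_comb \<alpha> (s # p) \<beta> (t # q) = (\<alpha> \<otimes> s \<oplus> \<beta> \<otimes> t) # list_comb \<alpha> p \<beta> q"
    by (simp add: list_comb_def)
  moreover have "(\<alpha> \<otimes> s \<oplus> \<beta> \<otimes> t) \<otimes> r [^] length q \<oplus> (\<alpha> \<otimes> eval p r \<oplus> \<beta> \<otimes> eval q r) =
      \<alpha> \<otimes> (s \<otimes> r [^] length q \<oplus> eval p r) \<oplus> \<beta> \<otimes> (t \<otimes> r [^] length q \<oplus> eval q r)"
    using * assms(4,5) by algebra
  ultimately show ?case using Cons by simp
qed

text \<open>
  The coefficients of the product of the forms \<open>u\<^sub>a X + v\<^sub>a\<close>: appending a zero multiplies a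
  coefficient list by \<open>X\<close>, and prepending one pads it to the same length.
\<close>

fun (in ring) form_coeffs :: "('c \<Rightarrow> 'a) \<Rightarrow> ('c \<Rightarrow> 'a) \<Rightarrow> 'c list \<Rightarrow> 'a list" where
  "form_coeffs u v [] = [\<one>]"
| "form_coeffs u v (a # as) =
     (let p = form_coeffs u v as in list_comb (u a) (p @ [\<zero>]) (v a) (\<zero> # p))"

lemma (in ring) length_form_coeffs [simp]: "length (form_coeffs u v as) = Suc (length as)"
  by (induction as) (simp_all add: Let_def)

lemma (in ring) set_form_coeffs:
  assumes "subring K R" "u ` set as \<subseteq> K" "v ` set as \<subseteq> K"
  shows "set (form_coeffs u v as) \<subseteq> K"
  using assms(2,3)
proof (induction as)
  case Nil
  then show ?case using subringE(3)[OF assms(1)] by simp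
next
  case (Cons a as)
  then show ?case
    unfolding form_coeffs.simps Let_def using subringE(2)[OF assms(1)]
    by (intro set_list_comb[OF assms(1)]) auto
qed

lemma (in ring) hd_form_coeffs:
  assumes "u ` set as \<subseteq> carrier R" "v ` set as \<subseteq> carrier R"
  shows "hd (form_coeffs u v as) = list_prod R u as"
  using assms
proof (induction as)
  case (Cons a as)
  have ne: "form_coeffs u v as \<noteq> []"
    using length_form_coeffs[of u v as] by force
  have "list_prod R u as \<in> carrier R"
    using Cons.prems by (intro list_prod_closed) auto
  then show ?case
    using Cons ne by (simp add: Let_def hd_list_comb hd_append)
qed simp

lemma (in cring) eval_form_coeffs:
  assumes "u ` set as \<subseteq> carrier R" "v ` set as \<subseteq> carrier R" "r \<in> carrier R"
  shows "eval (form_coeffs u v as) r = list_prod R (\<lambda>a. u a \<otimes> r \<oplus> v a) as"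
  using assms(1,2)
proof (induction as)
  case Nil
  then show ?case using assms(3) by simp
next
  case (Cons a as)
  define p where "p = form_coeffs u v as"
  have p: "set p \<subseteq> carrier R"
    unfolding p_def using Cons.prems by (intro set_form_coeffs carrier_is_subring) auto
  then have e: "eval p r \<in> carrier R"
    using assms(3) by (rule eval_in_carrier)
  have ua: "u a \<in> carrier R" "v a \<in> carrier R"
    using Cons.prems by auto
  have "eval (form_coeffs u v (a # as)) r
      = u a \<otimes> eval (p @ [\<zero>]) r \<oplus> v a \<otimes> eval (\<zero> # p) r"
    unfolding form_coeffs.simps Let_def p_def[symmetric]
    by (rule eval_list_comb) (use p ua assms(3) in auto)
  also have "eval (p @ [\<zero>]) r = eval p r \<otimes> r"
    using eval_append_aux[OF p zero_closed assms(3)] e assms(3) by simp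
  also have "eval (\<zero> # p) r = eval p r"
    using e assms(3) by simp
  also have "u a \<otimes> (eval p r \<otimes> r) \<oplus> v a \<otimes> eval p r = (u a \<otimes> r \<oplus> v a) \<otimes> eval p r"
    using e ua assms(3) by algebra
  finally show ?case using Cons by (simp add: p_def)
qed

section \<open>Unique factorisation into linear forms at an algebraic element\<close>

text \<open>
  The powers of \<open>x\<close> below the degree of its minimal polynomial are independent over \<open>K\<close>. Every use
  of the algebraic degree goes through this fact.
\<close>

lemma (in domain) eval_eq_zero_imp_coeffs_zero:
  assumes "subfield K R" "x \<in> carrier R" "algebraic K x"
    and "set p \<subseteq> K" "length p \<le> degree (Irr K x)" "eval p x = \<zero>"
  shows "set p \<subseteq> {\<zero>}"
proof -
  define n where "n = degree (Irr K x)"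
  define q where "q = replicate (n - length p) \<zero> @ p"
  have K: "subring K R" "K \<subseteq> carrier R"
    using subfieldE(1,3)[OF assms(1)] .
  have len: "length q = n" using assms(5) by (simp add: q_def n_def)
  have "independent K (exp_base x n)"
    unfolding n_def using assms(1,2,3) by (intro exp_base_independent) (simp_all add: over_def)
  moreover have "set q \<subseteq> K"
    using assms(4) subringE(2)[OF K(1)] by (auto simp: q_def)
  moreover have "combine q (exp_base x n) = \<zero>"
    using combine_eq_eval[of q x] len eval_replicate[of p x "n - length p"] assms(2,4,6) K(2)
    by (simp add: q_def)
  ultimately have "set (take (length (exp_base x n)) q) \<subseteq> {\<zero>}"
    by (rule independent_imp_trivial_combine[OF assms(1)])
  then have "set q \<subseteq> {\<zero>}"
    using len by (simp add: exp_base_def)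
  then show ?thesis by (simp add: q_def)
qed

lemma (in ring) eval_all_zero:
  "set p \<subseteq> {\<zero>} \<Longrightarrow> r \<in> carrier R \<Longrightarrow> eval p r = \<zero>"
  by (induction p) auto

text \<open>
  Lifting an identity from \<open>x\<close> to the polynomial ring. The difference of the two products vanishes at
  \<open>x\<close>. With fewer factors than the degree of \<open>x\<close> it is therefore the zero polynomial; with exactly
  that many factors its top coefficient must be known to cancel first. Being zero is then used in two
  forms, as equality of the top coefficients and as equality of the values at every \<open>r\<close>, that is, at
  all points of the projective line over the field.
\<close>

lemma (in field) form_products_agree:
  assumes K: "subfield K R" and x: "x \<in> carrier R" "algebraic K x"
    and uv: "u ` (set as \<union> set bs) \<subseteq> K" "v ` (set as \<union> set bs) \<subseteq> K"
    and len: "length as = length bs" and c: "c \<in> K"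
    and eq: "list_prod R (\<lambda>a. u a \<otimes> x \<oplus> v a) as = c \<otimes> list_prod R (\<lambda>a. u a \<otimes> x \<oplus> v a) bs"
    and top: "length as < degree (Irr K x) \<or>
              length as = degree (Irr K x) \<and> list_prod R u as = c \<otimes> list_prod R u bs"
  shows "list_prod R u as = c \<otimes> list_prod R u bs"
    and "\<And>r. r \<in> carrier R \<Longrightarrow>
      list_prod R (\<lambda>a. u a \<otimes> r \<oplus> v a) as = c \<otimes> list_prod R (\<lambda>a. u a \<otimes> r \<oplus> v a) bs"
proof -
  note Ksub = subfieldE(1,3)[OF K]
  define p where "p = form_coeffs u v as"
  define q where "q = form_coeffs u v bs"
  define d where "d = list_comb \<one> p (\<ominus> c) q"
  have pq: "set p \<subseteq> K" "set q \<subseteq> K"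
    unfolding p_def q_def using uv by (intro set_form_coeffs[OF Ksub(1)]; blast)+
  have d: "set d \<subseteq> K"
    unfolding d_def using pq c subringE(3,5)[OF Ksub(1)] by (intro set_list_comb[OF Ksub(1)]) auto
  have ld: "length d = Suc (length as)"
    by (simp add: d_def p_def q_def len)
  have uvR: "u ` set as \<subseteq> carrier R" "v ` set as \<subseteq> carrier R"
      "u ` set bs \<subseteq> carrier R" "v ` set bs \<subseteq> carrier R"
    using uv Ksub(2) by auto
  have cR: "c \<in> carrier R" using c Ksub(2) by auto
  have closed: "list_prod R u as \<in> carrier R" "list_prod R u bs \<in> carrier R"
    by (intro list_prod_closed uvR)+
  have diff: "\<one> \<otimes> y \<oplus> \<ominus> c \<otimes> z = \<zero> \<longleftrightarrow> y = c \<otimes> z" if "y \<in> carrier R" "z \<in> carrier R" for y z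
  proof -
    have "\<one> \<otimes> y \<oplus> \<ominus> c \<otimes> z = y \<ominus> c \<otimes> z" using that cR by algebra
    then show ?thesis using that cR by simp
  qed
  have eval_d: "eval d r = \<zero> \<longleftrightarrow>
      list_prod R (\<lambda>a. u a \<otimes> r \<oplus> v a) as = c \<otimes> list_prod R (\<lambda>a. u a \<otimes> r \<oplus> v a) bs"
    if r: "r \<in> carrier R" for r
  proof -
    have "eval d r = \<one> \<otimes> eval p r \<oplus> \<ominus> c \<otimes> eval q r"
      unfolding d_def using pq Ksub(2) cR r len
      by (intro eval_list_comb) (auto simp: p_def q_def)
    moreover have "eval p r \<in> carrier R" "eval q r \<in> carrier R"
      using pq Ksub(2) r by (auto intro: eval_in_carrier)
    ultimately show ?thesis
      using diff uvR r by (simp add: p_def q_def eval_form_coeffs)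
  qed
  have "p \<noteq> []" "q \<noteq> []"
    unfolding p_def q_def by (metis length_form_coeffs list.size(3) nat.distinct(1))+
  then have hd_d: "hd d = \<one> \<otimes> list_prod R u as \<oplus> \<ominus> c \<otimes> list_prod R u bs"
    unfolding d_def by (simp add: hd_list_comb p_def q_def hd_form_coeffs uvR)
  \<comment> \<open>In the boundary case the head \<open>e\<close> cancels and independence applies to the tail only.\<close>
  obtain e d' where d': "d = e # d'" using ld by (cases d) auto
  have dx: "eval d x = \<zero>" using eval_d[OF x(1)] eq by simp
  have d0: "set d \<subseteq> {\<zero>}"
  proof (cases "length as < degree (Irr K x)")
    case True
    then show ?thesis using eval_eq_zero_imp_coeffs_zero[OF K x d _ dx] ld by simp
  next
    case False
    then have top': "length as = degree (Irr K x)" "list_prod R u as = c \<otimes> list_prod R u bs"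
      using top by auto
    then have "e = \<zero>" using hd_d d' diff closed by simp
    moreover have "eval d' x \<in> carrier R"
      using d d' Ksub(2) x(1) by (auto intro: eval_in_carrier)
    ultimately have "eval d' x = \<zero>" using dx d' x(1) by simp
    then have "set d' \<subseteq> {\<zero>}"
      using eval_eq_zero_imp_coeffs_zero[OF K x, of d'] d d' ld top'(1) by simp
    then show ?thesis using \<open>e = \<zero>\<close> d' by simp
  qed
  then have "hd d = \<zero>" using d' by simp
  then show "list_prod R u as = c \<otimes> list_prod R u bs"
    using hd_d diff closed by simp
  show "list_prod R (\<lambda>a. u a \<otimes> r \<oplus> v a) as = c \<otimes> list_prod R (\<lambda>a. u a \<otimes> r \<oplus> v a) bs"
    if "r \<in> carrier R" for r
    using eval_d[OF that] eval_all_zero[OF d0 that] by simp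
qed

text \<open>
  If no form on the left is proportional to a different one on the right, the value of a product at
  \<open>x\<close>, even up to a scalar, determines the factors up to order, as long as there are fewer of them
  than the degree of \<open>x\<close>, or equally many with matching leading coefficients. Instead of unique factorisation in \<open>K[X]\<close>, the proof cancels a common factor, nonzero at
  \<open>x\<close>, as long as there is one. If the lists are disjoint, the projective zero of a form on the left
  must be a zero of some form on the right, which makes these two forms proportional.
\<close>

lemma (in field) linear_forms_unique:
  assumes K: "subfield K R" and x: "x \<in> carrier R" "algebraic K x"
    and uv: "u ` (set as \<union> set bs) \<subseteq> K" "v ` (set as \<union> set bs) \<subseteq> K"
    and sep: "\<And>a b. a \<in> set as \<Longrightarrow> b \<in> set bs \<Longrightarrow> u a \<otimes> v b = u b \<otimes> v a \<Longrightarrow> a = b"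
    and nz: "\<And>a. a \<in> set as \<union> set bs \<Longrightarrow> u a \<otimes> x \<oplus> v a \<noteq> \<zero>"
    and len: "length as = length bs" and c: "c \<in> K"
    and eq: "list_prod R (\<lambda>a. u a \<otimes> x \<oplus> v a) as = c \<otimes> list_prod R (\<lambda>a. u a \<otimes> x \<oplus> v a) bs"
    and top: "length as < degree (Irr K x) \<or>
              length as = degree (Irr K x) \<and> list_prod R u as = c \<otimes> list_prod R u bs"
  shows "mset as = mset bs"
  using uv sep nz len eq top
proof (induction "length as" arbitrary: as bs rule: less_induct)
  case less
  note uv = less.prems(1,2) and sep = less.prems(3) and nz = less.prems(4)
    and len = less.prems(5) and eq = less.prems(6) and top = less.prems(7)
  let ?f = "\<lambda>r a. u a \<otimes> r \<oplus> v a"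
  have KR: "K \<subseteq> carrier R" using subfieldE(3)[OF K] .
  have uvR: "u a \<in> carrier R" "v a \<in> carrier R" if "a \<in> set as \<union> set bs" for a
    using uv KR that by auto
  have fR: "?f r a \<in> carrier R" if "a \<in> set as \<union> set bs" "r \<in> carrier R" for a r
    using uvR that by auto
  have cR: "c \<in> carrier R" using c KR by auto
  show ?case
  proof (cases "set as \<inter> set bs = {}")
    case False
    then obtain a where a: "a \<in> set as" "a \<in> set bs" by auto
    define as' where "as' = remove1 a as"
    define bs' where "bs' = remove1 a bs"
    have sub: "set as' \<subseteq> set as" "set bs' \<subseteq> set bs"
      by (simp_all add: as'_def bs'_def set_remove1_subset)
    have lens: "length as = Suc (length as')" "length bs = Suc (length bs')"
      using a length_pos_if_in_set[of a] by (simp_all add: as'_def bs'_def length_remove1)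
    have P: "list_prod R (?f x) as' \<in> carrier R" "list_prod R (?f x) bs' \<in> carrier R"
      using fR x(1) sub by (auto intro!: list_prod_closed)
    have fa: "?f x a \<in> carrier R" using fR a x by auto
    have "?f x a \<otimes> list_prod R (?f x) as' = list_prod R (?f x) as"
      unfolding as'_def using a(1) fR x(1) by (intro list_prod_remove1[symmetric]) auto
    also have "\<dots> = c \<otimes> list_prod R (?f x) bs" by (rule eq)
    also have "list_prod R (?f x) bs = ?f x a \<otimes> list_prod R (?f x) bs'"
      unfolding bs'_def using a(2) fR x(1) by (intro list_prod_remove1) auto
    also have "c \<otimes> (?f x a \<otimes> list_prod R (?f x) bs') = ?f x a \<otimes> (c \<otimes> list_prod R (?f x) bs')"
      using cR fa P by (simp add: m_lcomm)
    finally have eq': "list_prod R (?f x) as' = c \<otimes> list_prod R (?f x) bs'"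
      using m_lcancel[of "?f x a"] nz[of a] a fa P cR by simp
    have "mset as' = mset bs'"
    proof (rule less.hyps)
      show "u ` (set as' \<union> set bs') \<subseteq> K" "v ` (set as' \<union> set bs') \<subseteq> K"
        using uv sub by blast+
      show "length as' < degree (Irr K x) \<or>
            length as' = degree (Irr K x) \<and> list_prod R u as' = c \<otimes> list_prod R u bs'"
        using top lens by linarith
    qed (use sub sep nz len lens eq' in auto)
    then show ?thesis
      using a by (metis as'_def bs'_def mset_remove1 insert_DiffM set_mset_mset)
  next
    case disj: True
    show ?thesis
    proof (cases as)
      case Nil
      then show ?thesis using len by simp
    next
      case (Cons a as')
      then have a: "a \<in> set as" by simp
      note agree = form_products_agree[OF K x uv len c eq top]
      have "list_prod R (?f x) as \<noteq> \<zero>"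
        using list_prod_eq_zero_iff[of "?f x" as] fR x(1) nz by auto
      then have c0: "c \<noteq> \<zero>"
        using eq list_prod_closed[of "?f x" bs] fR x(1) by (auto simp: image_subset_iff)
      have transfer: "\<exists>b\<in>set bs. g b = \<zero>"
        if "g a = \<zero>" "list_prod R g as = c \<otimes> list_prod R g bs" "g ` (set as \<union> set bs) \<subseteq> carrier R" for g
      proof -
        have "list_prod R g as = \<zero>" using that a by (subst list_prod_eq_zero_iff) auto
        moreover have "list_prod R g bs \<in> carrier R" using that by (intro list_prod_closed) auto
        ultimately have "list_prod R g bs = \<zero>" using that(2) c0 cR integral by metis
        then show ?thesis using that(3) list_prod_eq_zero_iff[of g bs] by auto
      qed
      have "\<exists>b\<in>set bs. u a \<otimes> v b = u b \<otimes> v a"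
      proof (cases "u a = \<zero>")
        \<comment> \<open>A constant form vanishes at infinity, so the top coefficients are compared.\<close>
        case True
        then obtain b where "b \<in> set bs" "u b = \<zero>"
          using transfer[of u] agree(1) uvR by blast
        then show ?thesis using True uvR a by (intro bexI[of _ b]) auto
      next
        case False
        \<comment> \<open>The root of the form of \<open>a\<close>.\<close>
        define r where "r = \<ominus> (inv (u a) \<otimes> v a)"
        have ua: "inv (u a) \<in> carrier R" "u a \<otimes> inv (u a) = \<one>"
          using False uvR[of a] a by (auto simp: field_Units)
        have r: "r \<in> carrier R" "u a \<otimes> r = \<ominus> v a"
        proof -
          show "r \<in> carrier R" using ua uvR[of a] a by (simp add: r_def)
          have "u a \<otimes> r = \<ominus> ((u a \<otimes> inv (u a)) \<otimes> v a)"
            unfolding r_def using ua(1) uvR[of a] a by (simp add: r_minus m_assoc)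
          then show "u a \<otimes> r = \<ominus> v a" using ua(2) uvR[of a] a by simp
        qed
        have "?f r a = \<zero>" using r uvR[of a] a by (simp add: l_neg)
        then obtain b where b: "b \<in> set bs" "?f r b = \<zero>"
          using transfer[of "?f r"] agree(2)[OF r(1)] fR r(1) by blast
        have "u a \<otimes> v b = u b \<otimes> v a"
        proof -
          have *: "u a \<in> carrier R" "v a \<in> carrier R" "u b \<in> carrier R" "v b \<in> carrier R"
            using uvR a b by auto
          have "u a \<otimes> v b = u a \<otimes> (u b \<otimes> r \<oplus> v b) \<ominus> u b \<otimes> (u a \<otimes> r)"
            using * r(1) by algebra
          also have "\<dots> = u b \<otimes> v a" unfolding b(2) r(2) using * by algebra
          finally show ?thesis .
        qed
        then show ?thesis using b(1) by blast
      qed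
      then show ?thesis using sep a disj by blast
    qed
  qed
qed

section \<open>Discrete logarithms modulo a subgroup\<close>

text \<open>
  In a finite cyclic group a subgroup \<open>H\<close> of index \<open>M\<close> consists exactly of the powers with
  exponent divisible by \<open>M\<close>. Lagrange's theorem in \<open>H\<close> gives one inclusion; there are only
  \<^term>\<open>card H\<close> such powers, so counting turns it into an equality. For \<open>H = {1}\<close> this describes
  exponents modulo \<open>q\<^sup>h - 1\<close>, for \<open>H = K\<^sup>\<times>\<close> exponents modulo the Singer modulus.
\<close>

lemma (in group) int_pow_mem_subgroup_iff:
  assumes fin: "finite (carrier G)" and t: "t \<in> carrier G" "generate G {t} = carrier G"
    and H: "subgroup H G" "M * card H = order G"
  shows "t [^] (i :: int) \<in> H \<longleftrightarrow> int M dvd i"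
proof -
  have finH: "finite H"
    using subgroup.subset[OF H(1)] fin by (rule finite_subset)
  have cH: "card H > 0"
    using finH subgroup.one_closed[OF H(1)] by (auto simp: card_gt_0_iff)
  have ord: "ord t = M * card H"
    using generate_pow_card[OF t(1)] t(2) H(2) by (simp add: order_def)
  have dvd: "int M dvd i" if "t [^] i \<in> H" for i :: int
  proof -
    interpret H: group "G\<lparr>carrier := H\<rparr>"
      by (rule subgroup.subgroup_is_group[OF H(1) group_axioms])
    have "(t [^] i) [^]\<^bsub>G\<lparr>carrier := H\<rparr>\<^esub> card H = \<one>"
      using H.pow_order_eq_1[of "t [^] i"] that finH by (simp add: order_def)
    then have "(t [^] i) [^] card H = \<one>"
      by (simp flip: nat_pow_consistent)
    then have "t [^] (i * int (card H)) = \<one>"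
      using t(1) by (simp add: int_pow_pow flip: int_pow_int)
    then have "int M * int (card H) dvd i * int (card H)"
      using int_pow_eq_id[OF t(1)] ord by simp
    then show ?thesis using cH by simp
  qed
  define T where "T = (\<lambda>j. t [^] (int M * int j)) ` {..<card H}"
  have "H \<subseteq> T"
  proof
    fix y assume y: "y \<in> H"
    then have "y \<in> generate G {t}"
      using t(2) subgroup.subset[OF H(1)] by auto
    then obtain i :: int where i: "y = t [^] i"
      using generate_pow[OF t(1)] by auto
    then obtain j where j: "i = int M * j" using dvd y by blast
    \<comment> \<open>The exponent matters only modulo \<open>M * card H\<close>, the order of \<open>t\<close>.\<close>
    define k where "k = nat (j mod int (card H))"
    have k: "k < card H" "int k = j mod int (card H)"
      using cH by (simp_all add: k_def nat_less_iff)
    have "int (ord t) dvd i - int M * int k"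
    proof -
      have "i - int M * int k = int M * (j - j mod int (card H))"
        by (simp add: j k algebra_simps)
      also have "\<dots> = int M * (int (card H) * (j div int (card H)))"
        by (simp add: minus_mod_eq_mult_div)
      finally show ?thesis by (simp add: ord)
    qed
    then have "t [^] (i - int M * int k) = \<one>"
      using int_pow_eq_id[OF t(1)] by simp
    then have "t [^] i = t [^] (int M * int k)"
      using int_pow_mult[OF t(1), of "i - int M * int k" "int M * int k"] t(1) by simp
    then show "y \<in> T" using k(1) i by (auto simp: T_def)
  qed
  moreover have "card T \<le> card H"
    unfolding T_def using card_image_le[of "{..<card H}"] by simp
  ultimately have T: "H = T"
    by (intro card_seteq) (auto simp: T_def)
  show ?thesis
  proof
    assume "int M dvd i"
    then obtain j where j: "i = int M * j" by blast
    have "t [^] int M \<in> H"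
    \<comment> \<open>For trivial \<open>H\<close> the index 1 does not occur in \<open>T\<close>, and \<open>M\<close> is the order of \<open>t\<close>.\<close>
    proof (cases "card H = 1")
      case True
      then have "t [^] int M = \<one>"
        using int_pow_eq_id[OF t(1), of "int M"] ord by simp
      then show ?thesis using subgroup.one_closed[OF H(1)] by simp
    next
      case False
      then have "t [^] int M \<in> T"
        unfolding T_def using cH by (intro image_eqI[of _ _ 1]) auto
      then show ?thesis using T by blast
    qed
    then have "(t [^] int M) [^] j \<in> H"
      by (rule subgroup_int_pow_closed[OF H(1)])
    then show "t [^] i \<in> H" using t(1) j by (simp add: int_pow_pow)
  qed (rule dvd)
qed

lemma (in group) subgroup_index_pos:
  assumes "finite (carrier G)" "M * card H = order G"
  shows "M > 0"
proof -
  have "order G > 0"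
    using assms(1) by (auto simp: order_def card_gt_0_iff)
  then show ?thesis using assms(2) by (cases M) auto
qed

lemma (in group) exists_logarithm_modulo_subgroup:
  assumes fin: "finite (carrier G)" and t: "t \<in> carrier G" "generate G {t} = carrier G"
    and H: "subgroup H G" "M * card H = order G" and y: "y \<in> carrier G"
  shows "\<exists>a\<in>{0..<int M}. \<exists>c\<in>H. t [^] a = c \<otimes> y"
proof -
  have "M > 0" using subgroup_index_pos[OF fin H(2)] .
  obtain k :: int where k: "y = t [^] k"
    using y t(2) generate_pow[OF t(1)] by auto
  define a where "a = k mod int M"
  have "int M dvd a - k" by (simp add: a_def flip: mod_eq_dvd_iff)
  then have "t [^] (a - k) \<in> H" using int_pow_mem_subgroup_iff[OF fin t H] by simp
  moreover have "t [^] a = t [^] (a - k) \<otimes> y"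
    unfolding k using int_pow_mult[OF t(1), of "a - k" k] by simp
  moreover have "a \<in> {0..<int M}" using \<open>M > 0\<close> by (simp add: a_def)
  ultimately show ?thesis by blast
qed

section \<open>Exponents of linear forms\<close>

text \<open>
  Only congruence is claimed: for a one-element list no reduction takes place, so the sum itself may
  lie outside \<open>{0..<M}\<close>.
\<close>

lemma semigroup_sum_integer_mod_group:
  assumes "as \<noteq> []"
  shows "semigroup_sum (integer_mod_group M) as mod int M = sum_list as mod int M"
proof -
  have *: "foldl (\<lambda>x y. (x + y) mod int M) s xs mod int M = (s + sum_list xs) mod int M"
    for s and xs :: "int list"
  proof (induction xs arbitrary: s)
    case (Cons y xs)
    then show ?case by (simp add: mod_add_left_eq add.assoc)
  qed simp
  show ?thesis
    using assms by (cases as) (simp_all add: semigroup_sum_def *)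
qed

text \<open>
  Degree at least 2 means \<open>x \<notin> K\<close>. In the cardinality count this separates the values of different
  points, and it keeps nonzero forms from vanishing at \<open>x\<close>.
\<close>

lemma (in domain) linear_form_coeffs_unique:
  assumes K: "subfield K R" and x: "x \<in> carrier R" "algebraic K x" "2 \<le> degree (Irr K x)"
    and st: "s \<in> K" "t \<in> K" "s' \<in> K" "t' \<in> K" and eq: "s \<otimes> x \<oplus> t = s' \<otimes> x \<oplus> t'"
  shows "s = s' \<and> t = t'"
proof -
  note Ksub = subfieldE(1,3)[OF K]
  have R: "s \<in> carrier R" "t \<in> carrier R" "s' \<in> carrier R" "t' \<in> carrier R"
    using st Ksub(2) by auto
  have "eval [s \<ominus> s', t \<ominus> t'] x = (s \<otimes> x \<oplus> t) \<ominus> (s' \<otimes> x \<oplus> t')"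
    using R x(1) by (simp, algebra)
  also have "\<dots> = \<zero>" using eq R x(1) by simp
  finally have "eval [s \<ominus> s', t \<ominus> t'] x = \<zero>" .
  moreover have "set [s \<ominus> s', t \<ominus> t'] \<subseteq> K"
    using st subringE(5,7)[OF Ksub(1)] by (simp add: a_minus_def)
  ultimately have "set [s \<ominus> s', t \<ominus> t'] \<subseteq> {\<zero>}"
    by (intro eval_eq_zero_imp_coeffs_zero[OF K x(1,2)]) (use x(3) in auto)
  then show ?thesis using R by simp
qed

text \<open>
  Two constants of the same name denote the multiplicative group of a ring, with the same definition;
  the facts on the one apply to the other.
\<close>

lemma mult_of_eq: "mult_of R = Multiplicative_Group.mult_of R"
  by (simp add: mult_of_def Multiplicative_Group.mult_of_def)

lemma (in field) nonneg_int_pow_mult_of: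
  assumes "a \<ge> 0"
  shows "t [^]\<^bsub>mult_of R\<^esub> (a :: int) = t [^] a"
  using assms by (cases rule: nonneg_int_cases) (simp add: int_pow_int nat_pow_mult_of)

text \<open>
  The common core of both constructions. \<open>P\<close> is a set of representatives of some points of the
  projective line over \<open>K\<close>, and \<open>A\<close> collects, modulo \<open>M\<close>, the logarithms of the forms
  \<open>u x + v\<close> up to a factor in the group \<open>H\<close> of scalars. Equal sums of elements of \<open>A\<close> give products of
  forms that agree at \<open>x\<close> up to a scalar in \<open>H\<close>, so the forms agree up to order. If there are as
  many factors as the degree of \<open>x\<close>, the products must have the same leading coefficient, which holds
  when all forms are monic and the only scalar is 1.
\<close>

theorem (in field) Bh_set_linear_form_exponents:
  assumes fin: "finite (carrier R)"
    and t: "\<theta> \<in> carrier (mult_of R)" "generate (mult_of R) {\<theta>} = carrier (mult_of R)"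
    and K: "subfield K R" and x: "x \<in> carrier R" "algebraic K x" "2 \<le> degree (Irr K x)"
    and H: "subgroup H (mult_of R)" "M * card H = order (mult_of R)" "H \<subseteq> K"
    and P: "P \<subseteq> K \<times> K" "(\<zero>, \<zero>) \<notin> P"
    and sep: "\<And>u v u' v'. (u, v) \<in> P \<Longrightarrow> (u', v') \<in> P \<Longrightarrow> u \<otimes> v' = u' \<otimes> v \<Longrightarrow> (u, v) = (u', v')"
    and h: "0 < h" "h < degree (Irr K x) \<or>
              h = degree (Irr K x) \<and> H = {\<one>} \<and> fst ` P \<subseteq> {\<one>}"
  defines "A \<equiv> {a \<in> carrier (integer_mod_group M).
                  \<exists>(u, v)\<in>P. \<exists>c\<in>H. \<theta> [^] a = c \<otimes> (u \<otimes> x \<oplus> v)}"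
  shows "Bh_set h (integer_mod_group M) A" and "card A = card P"
proof -
  interpret G: group "mult_of R"
    unfolding mult_of_eq by (rule field_mult_group)
  have finG: "finite (carrier (mult_of R))" using fin by simp
  have KR: "K \<subseteq> carrier R" using subfieldE(3)[OF K] .
  note Kring = subfieldE(1)[OF K]
  have M: "M > 0" using G.subgroup_index_pos[OF finG H(2)] .
  have tR: "\<theta> \<in> carrier R" using t(1) by simp
  have HR: "c \<in> carrier R" "c \<noteq> \<zero>" "c \<in> K" if "c \<in> H" for c
    using subgroup.subset[OF H(1)] H(3) that by auto
  have AM: "A \<subseteq> {0..<int M}" using M by (auto simp: A_def carrier_integer_mod_group)

  have "\<forall>a\<in>A. \<exists>pc. fst pc \<in> P \<and> snd pc \<in> H \<and>
      \<theta> [^] a = snd pc \<otimes> (fst (fst pc) \<otimes> x \<oplus> snd (fst pc))"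
    unfolding A_def by fastforce
  then obtain pc where pc: "\<And>a. a \<in> A \<Longrightarrow> fst (pc a) \<in> P \<and> snd (pc a) \<in> H \<and>
      \<theta> [^] a = snd (pc a) \<otimes> (fst (fst (pc a)) \<otimes> x \<oplus> snd (fst (pc a)))"
    by metis
  \<comment> \<open>\<open>p a\<close> is the point of \<open>P\<close> and \<open>c a\<close> the scalar that exhibit \<open>a\<close> as an element of \<open>A\<close>.\<close>
  define p where "p = fst \<circ> pc"
  define c where "c = snd \<circ> pc"
  have p: "p a \<in> P" "fst (p a) \<in> K" "snd (p a) \<in> K" and c: "c a \<in> H"
    and pow: "\<theta> [^] a = c a \<otimes> (fst (p a) \<otimes> x \<oplus> snd (p a))" if "a \<in> A" for a
    using pc[OF that] P(1) by (auto simp: p_def c_def)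
  note pR = p(2,3)[THEN subsetD[OF KR]]

  \<comment> \<open>Exponents of the same point differ by the exponent of a scalar, a multiple of \<open>M\<close>.\<close>
  have same: "a = b" if ab: "a \<in> A" "b \<in> A" "p a = p b" for a b
  proof -
    let ?y = "fst (p b) \<otimes> x \<oplus> snd (p b)"
    have y: "?y \<in> carrier R" using pR ab x(1) by simp
    have nn: "a \<ge> 0" "b \<ge> 0" using ab AM by auto
    have ca: "c a \<in> carrier (mult_of R)" "c b \<in> carrier (mult_of R)"
      using c ab subgroup.subset[OF H(1)] by auto
    define d where "d = c a \<otimes> inv\<^bsub>mult_of R\<^esub> c b"
    have inv: "inv\<^bsub>mult_of R\<^esub> c b \<in> carrier (mult_of R)" "inv\<^bsub>mult_of R\<^esub> c b \<otimes> c b = \<one>"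
      using G.inv_closed[OF ca(2)] G.l_inv[OF ca(2)] by simp_all
    have d: "d \<in> H"
      using subgroup.m_closed[OF H(1) c[OF ab(1)] subgroup.m_inv_closed[OF H(1) c[OF ab(2)]]]
      by (simp add: d_def)
    have "\<theta> [^] a = d \<otimes> \<theta> [^] b"
    proof -
      have "d \<otimes> (c b \<otimes> ?y) = c a \<otimes> (inv\<^bsub>mult_of R\<^esub> c b \<otimes> c b) \<otimes> ?y"
        unfolding d_def using ca inv(1) y by (simp add: m_assoc)
      also have "\<dots> = c a \<otimes> ?y" using inv(2) ca by simp
      finally show ?thesis using pow ab by simp
    qed
    then have *: "\<theta> [^]\<^bsub>mult_of R\<^esub> a = d \<otimes>\<^bsub>mult_of R\<^esub> \<theta> [^]\<^bsub>mult_of R\<^esub> b"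
      using nn by (simp add: nonneg_int_pow_mult_of)
    have "\<theta> [^]\<^bsub>mult_of R\<^esub> (a - b) = d"
    proof -
      have "\<theta> [^]\<^bsub>mult_of R\<^esub> (a - b) \<otimes>\<^bsub>mult_of R\<^esub> \<theta> [^]\<^bsub>mult_of R\<^esub> b = \<theta> [^]\<^bsub>mult_of R\<^esub> a"
        using G.int_pow_mult[OF t(1), of "a - b" b] by simp
      then show ?thesis
        using * G.int_pow_closed[OF t(1)] subgroup.subset[OF H(1)] d
        by (metis G.right_cancel subsetD)
    qed
    then have "int M dvd a - b"
      using G.int_pow_mem_subgroup_iff[OF finG t H(1,2)] d by metis
    then have "a mod int M = b mod int M" by (simp add: mod_eq_dvd_iff)
    then show ?thesis using ab AM by (auto simp: subset_iff)
  qed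

  have "bij_betw p A P"
  proof (rule bij_betw_imageI)
    show "inj_on p A" using same by (rule inj_onI)
    have "\<exists>a\<in>A. p a = (u, v)" if uv: "(u, v) \<in> P" for u v
    proof -
      have uvK: "u \<in> K" "v \<in> K" "(u, v) \<noteq> (\<zero>, \<zero>)" using uv P by auto
      then have uvR: "u \<in> carrier R" "v \<in> carrier R" using KR by auto
      have "u \<otimes> x \<oplus> v \<noteq> \<zero>"
        using linear_form_coeffs_unique[OF K x uvK(1,2), of \<zero> \<zero>] uvK(3) x(1)
          subringE(2)[OF Kring] by auto
      then have "u \<otimes> x \<oplus> v \<in> carrier (mult_of R)" using uvR x(1) by simp
      from G.exists_logarithm_modulo_subgroup[OF finG t H(1,2) this]
      obtain a e where a: "a \<in> {0..<int M}" "e \<in> H" "\<theta> [^] a = e \<otimes> (u \<otimes> x \<oplus> v)"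
        by (auto simp: nonneg_int_pow_mult_of)
      then have aA: "a \<in> A" using uv M by (auto simp: A_def carrier_integer_mod_group)
      let ?u = "fst (p a)" and ?v = "snd (p a)"
      note R = HR[OF c[OF aA]] HR[OF a(2)] pR[OF aA] uvR
      have "c a \<otimes> ?u \<otimes> x \<oplus> c a \<otimes> ?v = c a \<otimes> (?u \<otimes> x \<oplus> ?v)"
        using R x(1) by algebra
      also have "\<dots> = e \<otimes> (u \<otimes> x \<oplus> v)" using pow[OF aA] a(3) by simp
      also have "\<dots> = e \<otimes> u \<otimes> x \<oplus> e \<otimes> v" using R x(1) by algebra
      finally have "c a \<otimes> ?u = e \<otimes> u \<and> c a \<otimes> ?v = e \<otimes> v"
        using R p[OF aA] uvK by (intro linear_form_coeffs_unique[OF K x] subringE(6)[OF Kring]) auto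
      then have "c a \<otimes> e \<otimes> (?u \<otimes> v) = c a \<otimes> e \<otimes> (u \<otimes> ?v)"
        using R by (simp add: m_ac)
      then have "?u \<otimes> v = u \<otimes> ?v"
        using R by (subst (asm) m_lcancel) (auto simp: integral_iff)
      then have "p a = (u, v)" using sep[of ?u ?v u v] p(1)[OF aA] uv by simp
      then show ?thesis using aA by blast
    qed
    then show "p ` A = P" using p(1) by force
  qed
  then show "card A = card P" by (rule bij_betw_same_card)

  \<comment> \<open>The scalars are absorbed into the forms, so that the values at \<open>x\<close> are exactly powers of \<open>\<theta>\<close>.\<close>
  define u where "u a = c a \<otimes> fst (p a)" for a
  define v where "v a = c a \<otimes> snd (p a)" for a
  have uv: "u a \<in> K" "v a \<in> K" if "a \<in> A" for a
    unfolding u_def v_def using HR c p that by (auto intro: subringE(6)[OF Kring])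
  have form: "u a \<otimes> x \<oplus> v a = \<theta> [^]\<^bsub>mult_of R\<^esub> a" if "a \<in> A" for a
  proof -
    have "u a \<otimes> x \<oplus> v a = c a \<otimes> (fst (p a) \<otimes> x \<oplus> snd (p a))"
      unfolding u_def v_def using HR[OF c[OF that]] pR[OF that] x(1) by algebra
    then show ?thesis using pow[OF that] AM that by (auto simp: nonneg_int_pow_mult_of)
  qed
  have proportional: "a = b" if "a \<in> A" "b \<in> A" "u a \<otimes> v b = u b \<otimes> v a" for a b
  proof -
    note R = HR[OF c[OF that(1)]] HR[OF c[OF that(2)]] pR[OF that(1)] pR[OF that(2)]
    have "c a \<otimes> c b \<otimes> (fst (p a) \<otimes> snd (p b)) = u a \<otimes> v b"
      unfolding u_def v_def using R by algebra
    also have "\<dots> = u b \<otimes> v a" by (rule that(3))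
    also have "\<dots> = c a \<otimes> c b \<otimes> (fst (p b) \<otimes> snd (p a))"
      unfolding u_def v_def using R by algebra
    finally have "fst (p a) \<otimes> snd (p b) = fst (p b) \<otimes> snd (p a)"
      using R by (subst (asm) m_lcancel) (auto simp: integral_iff)
    then have "p a = p b"
      using sep[of "fst (p a)" "snd (p a)" "fst (p b)" "snd (p b)"] p(1) that by simp
    then show ?thesis using same that by blast
  qed
  show "Bh_set h (integer_mod_group M) A"
    unfolding Bh_set_def
  proof (intro conjI allI impI)
    show "A \<subseteq> carrier (integer_mod_group M)" by (auto simp: A_def)
    fix as bs :: "int list"
    assume "length as = h \<and> length bs = h \<and> set as \<subseteq> A \<and> set bs \<subseteq> A \<and>
      semigroup_sum (integer_mod_group M) as = semigroup_sum (integer_mod_group M) bs"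
    then have len: "length as = h" "length bs = h" and sub: "set as \<subseteq> A" "set bs \<subseteq> A"
      and sums: "semigroup_sum (integer_mod_group M) as = semigroup_sum (integer_mod_group M) bs"
      by auto
    have "sum_list as mod int M = sum_list bs mod int M"
      using sums h(1) len semigroup_sum_integer_mod_group[of as M]
        semigroup_sum_integer_mod_group[of bs M] by fastforce
    then have "int M dvd sum_list as - sum_list bs" by (simp add: mod_eq_dvd_iff)
    then have e: "\<theta> [^]\<^bsub>mult_of R\<^esub> (sum_list as - sum_list bs) \<in> H" (is "?e \<in> H")
      using G.int_pow_mem_subgroup_iff[OF finG t H(1,2)] by simp
    have prod: "list_prod R (\<lambda>a. u a \<otimes> x \<oplus> v a) xs = \<theta> [^]\<^bsub>mult_of R\<^esub> sum_list xs"
      if "set xs \<subseteq> A" for xs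
    proof -
      have "list_prod R (\<lambda>a. u a \<otimes> x \<oplus> v a) xs = list_prod R (\<lambda>a. \<theta> [^]\<^bsub>mult_of R\<^esub> a) xs"
        using form that by (intro list_prod_cong) auto
      also have "\<dots> = list_prod (mult_of R) (\<lambda>a. \<theta> [^]\<^bsub>mult_of R\<^esub> a) xs"
        by (simp add: list_prod_def)
      finally show ?thesis by (simp add: G.list_prod_int_pow[OF t(1)])
    qed
    have eq: "list_prod R (\<lambda>a. u a \<otimes> x \<oplus> v a) as = ?e \<otimes> list_prod R (\<lambda>a. u a \<otimes> x \<oplus> v a) bs"
      using prod[OF sub(1)] prod[OF sub(2)]
        G.int_pow_mult[OF t(1), of "sum_list as - sum_list bs" "sum_list bs"] by simp
    have one: "list_prod R u xs = \<one>" if "set xs \<subseteq> A" "H = {\<one>}" "fst ` P \<subseteq> {\<one>}" for xs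
    proof -
      have "u a = \<one>" if "a \<in> A" for a
        using c[OF that] p(1)[OF that] \<open>H = {\<one>}\<close> \<open>fst ` P \<subseteq> {\<one>}\<close> by (auto simp: u_def)
      then show ?thesis using \<open>set xs \<subseteq> A\<close> by (induction xs) auto
    qed
    show "mset as = mset bs"
    proof (rule linear_forms_unique[OF K x(1,2), of u as bs v ?e])
      show "u ` (set as \<union> set bs) \<subseteq> K" "v ` (set as \<union> set bs) \<subseteq> K"
        using uv sub by auto
      show "a = b" if "a \<in> set as" "b \<in> set bs" "u a \<otimes> v b = u b \<otimes> v a" for a b
        using proportional that sub by blast
      show "u a \<otimes> x \<oplus> v a \<noteq> \<zero>" if "a \<in> set as \<union> set bs" for a
        using form[of a] G.int_pow_closed[OF t(1), of a] that sub by auto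
      show "?e \<in> K" using e H(3) by blast
      show "length as < degree (Irr K x) \<or>
          length as = degree (Irr K x) \<and> list_prod R u as = ?e \<otimes> list_prod R u bs"
        using h(2) len(1) one sub e by auto
    qed (use len eq in auto)
  qed
qed

section \<open>The Bose--Chowla and Singer sets\<close>

lemma finite_field_setup_mult_group:
  assumes "finite_field_setup F K q n \<theta>" "0 < q"
  shows "finite (carrier F)" and "order (mult_of F) = q ^ n - 1"
proof -
  interpret field F using assms(1) by (simp add: finite_field_setup_def)
  have ord: "card (carrier F) = q ^ n"
    using assms(1) by (simp add: finite_field_setup_def order_def)
  then show fin: "finite (carrier F)"
    using assms(2) by (metis card.infinite power_not_zero less_not_refl)
  show "order (mult_of F) = q ^ n - 1"
    unfolding mult_of_eq using order_mult_of[OF fin] ord by (simp add: order_def)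
qed

text \<open>
  Here the forms are the monic ones, representing the affine points. Their number of factors \<open>h\<close>
  equals the degree of \<open>x\<close>, so no scalars but 1 can be admitted.
\<close>

theorem BoseCh_Bh_set:
  assumes ffs: "finite_field_setup F K q h \<theta>" and q: "0 < q" and h: "2 \<le> h"
    and deg: "has_algebraic_degree F K (\<theta> [^]\<^bsub>F\<^esub> b) h"
  shows "Bh_set h (integer_mod_group (q ^ h - 1)) (BoseCh F K \<theta> h q b) \<and>
         card (BoseCh F K \<theta> h q b) = q"
proof -
  interpret field F using ffs by (simp add: finite_field_setup_def)
  have K: "subfield K F" "card K = q"
    and t: "\<theta> \<in> carrier (mult_of F)" "generate (mult_of F) {\<theta>} = carrier (mult_of F)"
    using ffs by (simp_all add: finite_field_setup_def)
  interpret G: group "mult_of F"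
    unfolding mult_of_eq by (rule field_mult_group)
  define x where "x = \<theta> [^]\<^bsub>F\<^esub> b"
  have x: "x \<in> carrier F" "algebraic K x" "degree (Irr K x) = h"
    using deg by (simp_all add: has_algebraic_degree_def x_def)
  note KF = subfieldE(3)[OF K(1)]
  define P where "P = {\<one>\<^bsub>F\<^esub>} \<times> K"
  have PK: "P \<subseteq> K \<times> K" "(\<zero>\<^bsub>F\<^esub>, \<zero>\<^bsub>F\<^esub>) \<notin> P"
    using subringE(3)[OF subfieldE(1)[OF K(1)]] by (auto simp: P_def)
  have sep: "(u, v) = (u', v')" if "(u, v) \<in> P" "(u', v') \<in> P" "u \<otimes>\<^bsub>F\<^esub> v' = u' \<otimes>\<^bsub>F\<^esub> v" for u v u' v'
    using that KF by (auto simp: P_def subset_iff)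
  have H: "subgroup {\<one>\<^bsub>F\<^esub>} (mult_of F)" "(q ^ h - 1) * card {\<one>\<^bsub>F\<^esub>} = order (mult_of F)"
      "{\<one>\<^bsub>F\<^esub>} \<subseteq> K"
    using G.triv_subgroup finite_field_setup_mult_group(2)[OF ffs q]
      subringE(3)[OF subfieldE(1)[OF K(1)]] by simp_all
  have "BoseCh F K \<theta> h q b = {a \<in> carrier (integer_mod_group (q ^ h - 1)).
      \<exists>(u, v)\<in>P. \<exists>c\<in>{\<one>\<^bsub>F\<^esub>}. \<theta> [^]\<^bsub>F\<^esub> a = c \<otimes>\<^bsub>F\<^esub> (u \<otimes>\<^bsub>F\<^esub> x \<oplus>\<^bsub>F\<^esub> v)}"
    using x(1) KF by (auto simp: BoseCh_def P_def subset_iff simp flip: x_def)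
  moreover have card: "card P = q"
    by (simp add: P_def card_cartesian_product K(2))
  moreover have params: "2 \<le> degree (Irr K x)" "0 < h"
      "h < degree (Irr K x) \<or>
       h = degree (Irr K x) \<and> {\<one>\<^bsub>F\<^esub>} = {\<one>\<^bsub>F\<^esub>} \<and> fst ` P \<subseteq> {\<one>\<^bsub>F\<^esub>}"
    using x(3) h by (auto simp: P_def)
  moreover note Bh_set_linear_form_exponents[OF finite_field_setup_mult_group(1)[OF ffs q] t K(1) x(1,2) params(1) H PK sep params(2,3)]
  ultimately show ?thesis by (simp only:)
qed

lemma Singer_modulus_mult:
  assumes "0 < q"
  shows "Singer_modulus h q * (q - 1) = q ^ (h + 1) - 1"
proof -
  have "(q - 1) dvd q ^ n - 1" for n
  proof (induction n)
    case (Suc n)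
    have "q ^ Suc n - 1 = q * (q ^ n - 1) + (q - 1)"
      using assms by (simp add: diff_mult_distrib2)
    then show ?case using Suc by simp
  qed simp
  then show ?thesis
    unfolding Singer_modulus_def by (rule dvd_div_mult_self)
qed

text \<open>
  The degree \<open>h + 1\<close> exceeds the number of factors, so all nonzero scalars can be divided out and
  the point at infinity \<open>(0, 1)\<close> can be added. A nonzero \<open>u x + v\<close> is a scalar times \<open>x + v / u\<close> if
  \<open>u \<noteq> 0\<close>, and a scalar times 1 otherwise; this makes the Singer set one of the sets covered by
  the general theorem.
\<close>

theorem Singer_Bh_set:
  assumes ffs: "finite_field_setup F K q (h + 1) \<theta>" and q: "0 < q" and h: "1 \<le> h"
    and deg: "has_algebraic_degree F K (\<theta> [^]\<^bsub>F\<^esub> b) (h + 1)"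
  shows "Bh_set h (integer_mod_group (Singer_modulus h q)) (Singer F K \<theta> h q b) \<and>
         card (Singer F K \<theta> h q b) = q + 1"
proof -
  interpret field F using ffs by (simp add: finite_field_setup_def)
  have K: "subfield K F" "card K = q"
    and t: "\<theta> \<in> carrier (mult_of F)" "generate (mult_of F) {\<theta>} = carrier (mult_of F)"
    using ffs by (simp_all add: finite_field_setup_def)
  interpret G: group "mult_of F"
    unfolding mult_of_eq by (rule field_mult_group)
  define x where "x = \<theta> [^]\<^bsub>F\<^esub> b"
  have x: "x \<in> carrier F" "algebraic K x" "degree (Irr K x) = h + 1"
    using deg by (simp_all add: has_algebraic_degree_def x_def)
  note KF = subfieldE(3)[OF K(1)] and Kring = subfieldE(1)[OF K(1)]
  have K01: "\<zero>\<^bsub>F\<^esub> \<in> K" "\<one>\<^bsub>F\<^esub> \<in> K" using subringE(2,3)[OF Kring] by auto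
  have fin: "finite (carrier F)"
    using finite_field_setup_mult_group(1)[OF ffs q] .
  then have finK: "finite K" using KF finite_subset by blast
  define P where "P = insert (\<zero>\<^bsub>F\<^esub>, \<one>\<^bsub>F\<^esub>) ({\<one>\<^bsub>F\<^esub>} \<times> K)"
  have PK: "P \<subseteq> K \<times> K" "(\<zero>\<^bsub>F\<^esub>, \<zero>\<^bsub>F\<^esub>) \<notin> P"
    using K01 by (auto simp: P_def)
  have sep: "(u, v) = (u', v')" if "(u, v) \<in> P" "(u', v') \<in> P" "u \<otimes>\<^bsub>F\<^esub> v' = u' \<otimes>\<^bsub>F\<^esub> v" for u v u' v'
    using that KF by (auto simp: P_def subset_iff)
  have H: "subgroup (K - {\<zero>\<^bsub>F\<^esub>}) (mult_of F)"
      "Singer_modulus h q * card (K - {\<zero>\<^bsub>F\<^esub>}) = order (mult_of F)"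
      "K - {\<zero>\<^bsub>F\<^esub>} \<subseteq> K"
  proof -
    show "subgroup (K - {\<zero>\<^bsub>F\<^esub>}) (mult_of F)"
      unfolding mult_of_eq by (rule subgroup_mult_of[OF K(1)])
    show "Singer_modulus h q * card (K - {\<zero>\<^bsub>F\<^esub>}) = order (mult_of F)"
      using finite_field_setup_mult_group(2)[OF ffs q] Singer_modulus_mult[OF q, of h]
        finK K01 K(2) by simp
  qed auto
  have "Singer F K \<theta> h q b = {a \<in> carrier (integer_mod_group (Singer_modulus h q)).
      \<exists>(u, v)\<in>P. \<exists>c\<in>K - {\<zero>\<^bsub>F\<^esub>}. \<theta> [^]\<^bsub>F\<^esub> a = c \<otimes>\<^bsub>F\<^esub> (u \<otimes>\<^bsub>F\<^esub> x \<oplus>\<^bsub>F\<^esub> v)}"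
  proof -
    have "(\<exists>u\<in>K. \<exists>v\<in>K. y = u \<otimes>\<^bsub>F\<^esub> x \<oplus>\<^bsub>F\<^esub> v) \<longleftrightarrow>
        (\<exists>(u, v)\<in>P. \<exists>c\<in>K - {\<zero>\<^bsub>F\<^esub>}. y = c \<otimes>\<^bsub>F\<^esub> (u \<otimes>\<^bsub>F\<^esub> x \<oplus>\<^bsub>F\<^esub> v))"
      if y: "y \<noteq> \<zero>\<^bsub>F\<^esub>" for y
    proof
      assume "\<exists>u\<in>K. \<exists>v\<in>K. y = u \<otimes>\<^bsub>F\<^esub> x \<oplus>\<^bsub>F\<^esub> v"
      then obtain u v where uv: "u \<in> K" "v \<in> K" "y = u \<otimes>\<^bsub>F\<^esub> x \<oplus>\<^bsub>F\<^esub> v" by blast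
      then have uvF: "u \<in> carrier F" "v \<in> carrier F" using KF by auto
      show "\<exists>(u, v)\<in>P. \<exists>c\<in>K - {\<zero>\<^bsub>F\<^esub>}. y = c \<otimes>\<^bsub>F\<^esub> (u \<otimes>\<^bsub>F\<^esub> x \<oplus>\<^bsub>F\<^esub> v)"
      proof (cases "u = \<zero>\<^bsub>F\<^esub>")
        case True
        then have "y = v" using uv(3) uvF x(1) by simp
        then have "y = v \<otimes>\<^bsub>F\<^esub> (\<zero>\<^bsub>F\<^esub> \<otimes>\<^bsub>F\<^esub> x \<oplus>\<^bsub>F\<^esub> \<one>\<^bsub>F\<^esub>)" "v \<in> K - {\<zero>\<^bsub>F\<^esub>}"
          using uvF x(1) uv y by simp_all
        then show ?thesis unfolding P_def by blast
      next
        case False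
        then have inv: "inv\<^bsub>F\<^esub> u \<in> K" "u \<otimes>\<^bsub>F\<^esub> inv\<^bsub>F\<^esub> u = \<one>\<^bsub>F\<^esub>"
          using subfield_m_inv[OF K(1), of u] uv by auto
        then have iF: "inv\<^bsub>F\<^esub> u \<in> carrier F" using KF by auto
        have "u \<otimes>\<^bsub>F\<^esub> (\<one>\<^bsub>F\<^esub> \<otimes>\<^bsub>F\<^esub> x \<oplus>\<^bsub>F\<^esub> inv\<^bsub>F\<^esub> u \<otimes>\<^bsub>F\<^esub> v)
            = u \<otimes>\<^bsub>F\<^esub> x \<oplus>\<^bsub>F\<^esub> (u \<otimes>\<^bsub>F\<^esub> inv\<^bsub>F\<^esub> u) \<otimes>\<^bsub>F\<^esub> v"
          using iF uvF x(1) by (simp add: r_distr m_assoc)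
        then have "y = u \<otimes>\<^bsub>F\<^esub> (\<one>\<^bsub>F\<^esub> \<otimes>\<^bsub>F\<^esub> x \<oplus>\<^bsub>F\<^esub> inv\<^bsub>F\<^esub> u \<otimes>\<^bsub>F\<^esub> v)"
          using inv(2) uv(3) uvF by simp
        moreover have "(\<one>\<^bsub>F\<^esub>, inv\<^bsub>F\<^esub> u \<otimes>\<^bsub>F\<^esub> v) \<in> P"
          using subringE(6)[OF Kring inv(1) uv(2)] by (simp add: P_def)
        ultimately show ?thesis using False uv(1) by blast
      qed
    next
      assume "\<exists>(u, v)\<in>P. \<exists>c\<in>K - {\<zero>\<^bsub>F\<^esub>}. y = c \<otimes>\<^bsub>F\<^esub> (u \<otimes>\<^bsub>F\<^esub> x \<oplus>\<^bsub>F\<^esub> v)"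
      then obtain u v c where uvc: "u \<in> K" "v \<in> K" "c \<in> K"
          "y = c \<otimes>\<^bsub>F\<^esub> (u \<otimes>\<^bsub>F\<^esub> x \<oplus>\<^bsub>F\<^esub> v)"
        using PK(1) by blast
      then have uvcF: "u \<in> carrier F" "v \<in> carrier F" "c \<in> carrier F" using KF by auto
      have "y = (c \<otimes>\<^bsub>F\<^esub> u) \<otimes>\<^bsub>F\<^esub> x \<oplus>\<^bsub>F\<^esub> c \<otimes>\<^bsub>F\<^esub> v"
        unfolding uvc(4) using uvcF x(1) by (simp add: r_distr m_assoc)
      then show "\<exists>u\<in>K. \<exists>v\<in>K. y = u \<otimes>\<^bsub>F\<^esub> x \<oplus>\<^bsub>F\<^esub> v"
        using uvc(1-3) by (blast intro: subringE(6)[OF Kring])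
    qed
    moreover have "\<theta> [^]\<^bsub>F\<^esub> a \<noteq> \<zero>\<^bsub>F\<^esub>" if "a \<in> carrier (integer_mod_group (Singer_modulus h q))" for a
    proof -
      have "finite (carrier (mult_of F))" using fin by simp
      then have "a \<ge> 0"
        using that G.subgroup_index_pos[OF _ H(2)] by (simp add: carrier_integer_mod_group)
      then show ?thesis
        using G.int_pow_closed[OF t(1), of a] by (simp add: nonneg_int_pow_mult_of)
    qed
    ultimately show ?thesis
      unfolding Singer_def x_def[symmetric] by (intro Collect_cong conj_cong refl) simp
  qed
  moreover have card: "card P = q + 1"
    using finK by (subst P_def, subst card_insert_disjoint) (auto simp: card_cartesian_product K(2))
  moreover have params: "2 \<le> degree (Irr K x)" "0 < h"
      "h < degree (Irr K x) \<or>
       h = degree (Irr K x) \<and> K - {\<zero>\<^bsub>F\<^esub>} = {\<one>\<^bsub>F\<^esub>} \<and> fst ` P \<subseteq> {\<one>\<^bsub>F\<^esub>}"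
    using x(3) h by auto
  moreover note Bh_set_linear_form_exponents[OF fin t K(1) x(1,2) params(1) H PK sep params(2,3)]
  ultimately show ?thesis by (simp only:)
qed

theorem theorem3:
  fixes h q :: nat
  assumes "h \<ge> 2" and "primepow q"
  shows "(\<forall>(F :: ('a, 'm) ring_scheme) K \<theta> b.
            finite_field_setup F K q h \<theta> \<and>
            b \<in> carrier (integer_mod_group (q ^ h - 1)) \<and>
            has_algebraic_degree F K (\<theta> [^]\<^bsub>F\<^esub> b) h \<longrightarrow>
              Bh_set h (integer_mod_group (q ^ h - 1)) (BoseCh F K \<theta> h q b) \<and>
              card (BoseCh F K \<theta> h q b) = q) \<and>
         (\<forall>(F :: ('b, 'n) ring_scheme) K \<theta> b.
            finite_field_setup F K q (h + 1) \<theta> \<and>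
            b \<in> carrier (integer_mod_group (Singer_modulus h q)) \<and>
            has_algebraic_degree F K (\<theta> [^]\<^bsub>F\<^esub> b) (h + 1) \<longrightarrow>
              Bh_set h (integer_mod_group (Singer_modulus h q)) (Singer F K \<theta> h q b) \<and>
              card (Singer F K \<theta> h q b) = q + 1)"
proof -
  have q: "0 < q" and h: "1 \<le> h"
    using assms by (auto intro: primepow_gt_0_nat)
  show ?thesis
    by (rule conjI; intro allI impI; elim conjE;
        (rule BoseCh_Bh_set[OF _ q assms(1)] | rule Singer_Bh_set[OF _ q h]); assumption)
qed

end
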